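(* Let $n\ge2$, let $V$ be a finite nonempty set, $X=V^n$, $\tau>0$, and let $p_{\theta,\tau}(\cdot\mid x_{-i})$ be the temperature-scaled conditionals induced by local scores $s_i$, as defined in the context. If there exists a probability distribution $\pi$ on $X$ compatible with these conditionals, then the rectangle incompatibility $\delta$ (defined in the context) equals $0$ for every rectangle, i.e. for every $\mathbf x\in X$, every pair of positions $i\ne j$ and every pair of replacement tokens $A',B'\in V$.
   Context: Setting. $V$ is a finite nonempty vocabulary, $X=V^n$. For $x\in X$ and $i\in\{1,\dots,n\}$, $x_{-i}$ denotes $x$ with the $i$-th coordinate removed. For each $i$, each context $x_{-i}$ and each $a\in V$ an arbitrary real number (local score) $s_i(a;x_{-i})$ is given. For $\tau>0$, $$p_{\theta,\tau}(a\mid x_{-i})=\frac{\exp(s_i(a;x_{-i})/\tau)}{\sum_{b\in V}\exp(s_i(b;x_{-i})/\tau)}.$$ Compatibility: a probability distribution $\pi$ on $X$ is compatible with the local conditionals if for every $i$, every context $x_{-i}$ with $\pi(X_{-i}=x_{-i})>0$ and every $a\in V$, $$\pi(X_i=a\mid X_{-i}=x_{-i})=p_{\theta,\tau}(a\mid x_{-i}).$$ Rectangle: fix $\mathbf x\in X$, positions $i\ne j$, current tokens $A=x_i$, $B=x_j$ and replacement tokens $A',B'\in V$. Let $\mathbf y$ be $\mathbf x$ with position $i$ set to $A'$; $\mathbf w$ be $\mathbf x$ with position $j$ set to $B'$; $\mathbf z$ be $\mathbf x$ with position $i$ set to $A'$ and position $j$ set to $B'$. The edge log-ratios are $$s_{\mathbf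 x\to\mathbf y}=\log p_{\theta,\tau}(A'\mid \mathbf x_{-i})-\log p_{\theta,\tau}(A\mid \mathbf x_{-i}),\qquad s_{\mathbf y\to\mathbf z}=\log p_{\theta,\tau}(B'\mid \mathbf y_{-j})-\log p_{\theta,\tau}(B\mid \mathbf y_{-j}),$$ $$s_{\mathbf x\to\mathbf w}=\log p_{\theta,\tau}(B'\mid \mathbf x_{-j})-\log p_{\theta,\tau}(B\mid \mathbf x_{-j}),\qquad s_{\mathbf w\to\mathbf z}=\log p_{\theta,\tau}(A'\mid \mathbf w_{-i})-\log p_{\theta,\tau}(A\mid \mathbf w_{-i}).$$ The rectangle incompatibility is $\delta=(s_{\mathbf x\to\mathbf y}+s_{\mathbf y\to\mathbf z})-(s_{\mathbf x\to\mathbf w}+s_{\mathbf w\to\mathbf z})$. *)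

theory Defs
  imports "HOL-Probability.Probability"
begin

(* V^n is the set of functions from {1..n} to V that are "undefined" outside {1..n}. *)
definition seqs :: "nat \<Rightarrow> 'v set \<Rightarrow> (nat \<Rightarrow> 'v) set" where
  "seqs n V = {1..n} \<rightarrow>\<^sub>E V"

(* The context x_{-i}: the i-th coordinate is removed, the others keep their index. *)
definition remove_pos :: "nat \<Rightarrow> nat \<Rightarrow> (nat \<Rightarrow> 'v) \<Rightarrow> (nat \<Rightarrow> 'v)" where
  "remove_pos n i x = restrict x ({1..n} - {i})"

definition contexts :: "nat \<Rightarrow> 'v set \<Rightarrow> nat \<Rightarrow> (nat \<Rightarrow> 'v) set" where
  "contexts n V i = ({1..n} - {i}) \<rightarrow>\<^sub>E V"

(* The score s_i(a; c) is written s i a c. *)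
definition local_cond ::
  "'v set \<Rightarrow> (nat \<Rightarrow> 'v \<Rightarrow> (nat \<Rightarrow> 'v) \<Rightarrow> real) \<Rightarrow> real \<Rightarrow> nat \<Rightarrow> 'v \<Rightarrow> (nat \<Rightarrow> 'v) \<Rightarrow> real" where
  "local_cond V s \<tau> i a c = exp (s i a c / \<tau>) / (\<Sum>b\<in>V. exp (s i b c / \<tau>))"

definition compatible ::
  "nat \<Rightarrow> 'v set \<Rightarrow> (nat \<Rightarrow> 'v \<Rightarrow> (nat \<Rightarrow> 'v) \<Rightarrow> real) \<Rightarrow> real \<Rightarrow> (nat \<Rightarrow> 'v) pmf \<Rightarrow> bool" where
  "compatible n V s \<tau> \<pi> \<longleftrightarrow>
     (\<forall>i\<in>{1..n}. \<forall>c\<in>contexts n V i.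
        \<P>(x in measure_pmf \<pi>. remove_pos n i x = c) > 0 \<longrightarrow>
        (\<forall>a\<in>V. \<P>(x in measure_pmf \<pi>. x i = a \<bar> remove_pos n i x = c) = local_cond V s \<tau> i a c))"

(* log p(a' | u_{-i}) - log p(u_i | u_{-i}): log-ratio of the edge from u to u(i := a'). *)
definition edge_log_ratio ::
  "nat \<Rightarrow> 'v set \<Rightarrow> (nat \<Rightarrow> 'v \<Rightarrow> (nat \<Rightarrow> 'v) \<Rightarrow> real) \<Rightarrow> real \<Rightarrow> (nat \<Rightarrow> 'v) \<Rightarrow> nat \<Rightarrow> 'v \<Rightarrow> real" where
  "edge_log_ratio n V s \<tau> u i a' =
     ln (local_cond V s \<tau> i a' (remove_pos n i u)) - ln (local_cond V s \<tau> i (u i) (remove_pos n i u))"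

definition rect_incompat ::
  "nat \<Rightarrow> 'v set \<Rightarrow> (nat \<Rightarrow> 'v \<Rightarrow> (nat \<Rightarrow> 'v) \<Rightarrow> real) \<Rightarrow> real \<Rightarrow>
   (nat \<Rightarrow> 'v) \<Rightarrow> nat \<Rightarrow> nat \<Rightarrow> 'v \<Rightarrow> 'v \<Rightarrow> real" where
  "rect_incompat n V s \<tau> x i j A' B' =
     (let y = x(i := A'); w = x(j := B')
      in (edge_log_ratio n V s \<tau> x i A' + edge_log_ratio n V s \<tau> y j B')
         - (edge_log_ratio n V s \<tau> x j B' + edge_log_ratio n V s \<tau> w i A'))"

end

(* A compatible distribution has full support, because the local conditionals are strictly
   positive and the support is nonempty: one coordinate after the other can be replaced. Each edge
   log-ratio is then a difference of values of the potential log \<pi>, so both paths around a rectangle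
   have the same total. *)
theory Submission imports Defs begin

lemma local_cond_pos:
  assumes "finite V" and "V \<noteq> {}"
  shows "local_cond V s \<tau> i a c > 0"
  unfolding local_cond_def using assms by (intro divide_pos_pos sum_pos) auto

lemma remove_pos_in_contexts:
  assumes "x \<in> seqs n V"
  shows "remove_pos n i x \<in> contexts n V i"
  using assms unfolding seqs_def contexts_def remove_pos_def by auto

lemma fun_upd_in_seqs:
  assumes "x \<in> seqs n V" and "i \<in> {1..n}" and "a \<in> V"
  shows "x(i := a) \<in> seqs n V"
  using assms unfolding seqs_def by (auto simp: PiE_iff extensional_def)

text \<open>Makes a value at \<open>i\<close> together with a context single out one sequence.
  Membership in \<open>seqs n V\<close> settles the indices outside \<open>{1..n}\<close>, where
  both functions are \<open>undefined\<close>.\<close>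

lemma eq_fun_upd_iff_remove_pos:
  assumes "x \<in> seqs n V" and "u \<in> seqs n V" and "i \<in> {1..n}"
  shows "x = u(i := a) \<longleftrightarrow> x i = a \<and> remove_pos n i x = remove_pos n i u"
proof
  assume "x = u(i := a)"
  then show "x i = a \<and> remove_pos n i x = remove_pos n i u"
    by (auto simp: remove_pos_def restrict_def)
next
  assume r: "x i = a \<and> remove_pos n i x = remove_pos n i u"
  show "x = u(i := a)"
  proof
    fix k
    have "x k = u k" if "k \<in> {1..n}" "k \<noteq> i"
      using r that unfolding remove_pos_def restrict_def by (metis Diff_iff singletonD)
    moreover have "x k = u k" if "k \<notin> {1..n}"
      using assms(1,2) that unfolding seqs_def by (metis PiE_arb)
    ultimately show "x k = (u(i := a)) k"
      using r by (cases "k = i"; cases "k \<in> {1..n}") auto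
  qed
qed

lemma remove_pos_prob_pos:
  assumes "u \<in> set_pmf \<pi>"
  shows "\<P>(x in measure_pmf \<pi>. remove_pos n i x = remove_pos n i u) > 0"
  using assms by (intro measure_pmf_posI[of u]) auto

text \<open>Chain rule at a context that has positive probability because \<open>u\<close> itself
  realises it. The second factor does not depend on \<open>a\<close>, so it cancels when two tokens
  at position \<open>i\<close> are compared.\<close>

lemma compatible_pmf_fun_upd:
  assumes supp: "set_pmf \<pi> \<subseteq> seqs n V" and comp: "compatible n V s \<tau> \<pi>"
    and u: "u \<in> set_pmf \<pi>" and i: "i \<in> {1..n}" and a: "a \<in> V"
  shows "pmf \<pi> (u(i := a)) = local_cond V s \<tau> i a (remove_pos n i u)
           * \<P>(x in measure_pmf \<pi>. remove_pos n i x = remove_pos n i u)"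
proof -
  let ?c = "remove_pos n i u"
  have useq: "u \<in> seqs n V" using u supp by auto
  have pos: "\<P>(x in measure_pmf \<pi>. remove_pos n i x = ?c) > 0"
    using u by (rule remove_pos_prob_pos)
  \<comment> \<open>The event and the singleton are only shown to agree on \<open>seqs n V\<close>.
    This suffices, since \<open>\<pi>\<close> is supported there: the sets are equal almost
    everywhere.\<close>
  have "\<P>(x in measure_pmf \<pi>. x i = a \<and> remove_pos n i x = ?c)
      = measure (measure_pmf \<pi>) {u(i := a)}"
    using eq_fun_upd_iff_remove_pos[OF _ useq i] supp
    by (intro measure_pmf.finite_measure_eq_AE) (auto simp: AE_measure_pmf_iff)
  moreover have "\<P>(x in measure_pmf \<pi>. x i = a \<bar> remove_pos n i x = ?c) = local_cond V s \<tau> i a ?c"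
    using comp i a pos remove_pos_in_contexts[OF useq] unfolding compatible_def by blast
  ultimately show ?thesis
    using pos by (simp add: cond_prob_def measure_pmf_single field_simps)
qed

lemma compatible_fun_upd_in_support:
  assumes "finite V" and "V \<noteq> {}" and "set_pmf \<pi> \<subseteq> seqs n V" and "compatible n V s \<tau> \<pi>"
    and "u \<in> set_pmf \<pi>" and "i \<in> {1..n}" and "a \<in> V"
  shows "u(i := a) \<in> set_pmf \<pi>"
proof -
  have "pmf \<pi> (u(i := a)) > 0"
    using compatible_pmf_fun_upd[OF assms(3-7)] local_cond_pos[OF assms(1,2)]
      remove_pos_prob_pos[OF assms(5)] by simp
  then show ?thesis by (simp add: pmf_positive_iff)
qed

lemma compatible_full_support:
  assumes "finite V" and "V \<noteq> {}" and supp: "set_pmf \<pi> \<subseteq> seqs n V" and "compatible n V s \<tau> \<pi>"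
  shows "set_pmf \<pi> = seqs n V"
proof
  show "seqs n V \<subseteq> set_pmf \<pi>"
  proof
    fix y assume y: "y \<in> seqs n V"
    obtain u where u: "u \<in> set_pmf \<pi>" using set_pmf_not_empty by fast
    \<comment> \<open>Walk from a support point \<open>u\<close> to the target \<open>y\<close>,
      copying the coordinates in \<open>S\<close> from \<open>y\<close> one at a time; each copy is
      a single replacement, which stays in the support.\<close>
    have "override_on u y S \<in> set_pmf \<pi>" if "finite S" "S \<subseteq> {1..n}" for S
      using that
    proof (induction S rule: finite_induct)
      case empty
      then show ?case using u by simp
    next
      case (insert k S)
      moreover have "y k \<in> V" using y insert.prems unfolding seqs_def by auto
      ultimately show ?case
        using compatible_fun_upd_in_support[OF assms, of "override_on u y S" k "y k"]
        by (simp add: override_on_insert fun_upd_def)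
    qed
    moreover have "override_on u y {1..n} = y"
    proof
      fix k
      show "override_on u y {1..n} k = y k"
        using y u supp unfolding seqs_def override_on_def by (metis PiE_arb subsetD)
    qed
    ultimately show "y \<in> set_pmf \<pi>" by (metis finite_atLeastAtMost order_refl)
  qed
qed (rule supp)

text \<open>Full support makes the formula available at every \<open>u\<close>. The log-probability
  of the context occurs in both terms and drops out of the difference.\<close>

lemma compatible_edge_log_ratio:
  assumes "finite V" and "V \<noteq> {}" and supp: "set_pmf \<pi> \<subseteq> seqs n V"
    and comp: "compatible n V s \<tau> \<pi>"
    and u: "u \<in> seqs n V" and i: "i \<in> {1..n}" and a: "a \<in> V"
  shows "edge_log_ratio n V s \<tau> u i a = ln (pmf \<pi> (u(i := a))) - ln (pmf \<pi> u)"
proof -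
  have u': "u \<in> set_pmf \<pi>" using compatible_full_support[OF assms(1-4)] u by simp
  have "u i \<in> V" using u i unfolding seqs_def by auto
  \<comment> \<open>The first instance rewrites position \<open>i\<close> with its own token, and
    \<open>u(i := u i)\<close> is \<open>u\<close>, so it gives \<open>pmf \<pi> u\<close>.\<close>
  from compatible_pmf_fun_upd[OF supp comp u' i this] compatible_pmf_fun_upd[OF supp comp u' i a]
  show ?thesis
    using local_cond_pos[OF assms(1,2)] remove_pos_prob_pos[OF u']
    by (simp add: edge_log_ratio_def ln_mult_pos)
qed

theorem proposition4:
  fixes n :: nat and V :: "'v set"
    and s :: "nat \<Rightarrow> 'v \<Rightarrow> (nat \<Rightarrow> 'v) \<Rightarrow> real" and \<tau> :: real
  assumes "n \<ge> 2" and "finite V" and "V \<noteq> {}" and "\<tau> > 0"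
    and "\<exists>\<pi> :: (nat \<Rightarrow> 'v) pmf. set_pmf \<pi> \<subseteq> seqs n V \<and> compatible n V s \<tau> \<pi>"
  shows "\<forall>x\<in>seqs n V. \<forall>i\<in>{1..n}. \<forall>j\<in>{1..n}. i \<noteq> j \<longrightarrow>
           (\<forall>A'\<in>V. \<forall>B'\<in>V. rect_incompat n V s \<tau> x i j A' B' = 0)"
proof (intro ballI impI)
  fix x i j A' B'
  assume x: "x \<in> seqs n V" and ij: "i \<in> {1..n}" "j \<in> {1..n}" "i \<noteq> j" and "A' \<in> V" "B' \<in> V"
  obtain \<pi> where "set_pmf \<pi> \<subseteq> seqs n V" "compatible n V s \<tau> \<pi>"
    using assms(5) by blast
  note edge = compatible_edge_log_ratio[OF assms(2,3) this]
  show "rect_incompat n V s \<tau> x i j A' B' = 0"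
    using x ij \<open>A' \<in> V\<close> \<open>B' \<in> V\<close>
    \<comment> \<open>Each path telescopes to its endpoints. \<open>fun_upd_twist\<close>, which
      needs \<open>i \<noteq> j\<close>, identifies the two far corners. Deleting
      \<open>atLeastAtMost_iff\<close> keeps the memberships in \<open>{1..n}\<close> in the form in
      which \<open>edge\<close> asks for them.\<close>
    by (simp add: rect_incompat_def edge fun_upd_in_seqs fun_upd_twist del: atLeastAtMost_iff)
qed

end
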